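(* The map $\mathcal T_a$ is a strict contraction on the bounded Borel matrix functions $G:(0,\infty)\to\mathbb R^{m\times m}$ with the supremum row-sum norm $\|G\|_\infty=\sup_{v>0}|G(v)|$, with Lipschitz constant $$\beta:=\max_{i\in E}\frac{\lambda_i}{w+\lambda_i}\big(1-e^{-z_ia}\big)<1 .$$
   Context: Model. Let $E=\{1,\dots,m\}$; for each $i\in E$ let $c_i>0$, $\lambda_i>0$, $p_i\in(0,1)$, and let $Q=(q_{ij})_{i,j\in E}$ be a stochastic matrix. $(X,J)$ is the Markov process on $[0,\infty)\times E$ with the following dynamics: while the phase $J$ equals $i$, the level $X$ increases linearly with slope $1/c_i$ and the next jump occurs at rate $\lambda_i$; at a jump from $(x,i)$ the process moves to $(p_i x,j)$ with probability $q_{ij}$ ($j=i$ is allowed). Fix $w>0$ and $a>0$; put $z_i=c_i(\lambda_i+w)$. For a matrix $M$, $|M|=\max_i\sum_j|M_{ij}|$. For $v>0$, $\mathbb E_{(v,v),i}$ denotes expectation given $X(0)=v$, $J(0)=i$ (and initial running minimum $v$). Let $\tau_{\uparrow v+a}=\inf\{t\ge0:X(t)\ge v+a\}$ and $\rho_v=\inf\{t>0:X(t)<v\}$. Define the matrices $$Z^{+}_{ij}(v)=\mathbb E_{(v,v),i}\big[e^{-w\tau_{\uparrow v+a}};\tau_{\uparrow v+a}<\rho_v,\ J(\tau_{\uparrow v+a})=j\big],$$ $$(\mathcal V_aG)_{ij}(v)=\mathbb E_{(v,v),i}\big[e^{-w\rho_v}G_{J(\rho_v),j}(X(\rho_v));\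 \rho_v<\tau_{\uparrow v+a}\big],$$ and the affine map $(\mathcal T_aG)(v)=Z^{+}(v)+(\mathcal V_aG)(v)$, $v>0$. *)

theory Defs
  imports "HOL-Probability.Probability"
begin

text \<open>
  The phase set is a finite type \<open>'e\<close>, so that \<open>m \<times> m\<close> matrices are elements of
  \<open>real ^ 'e ^ 'e\<close>, with \<open>A $ i $ j\<close> the entry in row \<open>i\<close>, column \<open>j\<close>.
\<close>

section \<open>The Markov process\<close>

text \<open>
  The process is realised canonically. The randomness consumed is a sequence
  \<open>\<omega> n = (S\<^sub>n, J\<^sub>n\<^sub>+\<^sub>1)\<close>: the time between the \<open>n\<close>-th and the \<open>(n+1)\<close>-st jump and the phase
  entered at the \<open>(n+1)\<close>-st jump. Given the past, with current phase \<open>i\<close>, the holding time is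
  exponential with rate \<open>lam i\<close> and the next phase is chosen independently of it by row \<open>i\<close>
  of \<open>Q\<close>; the jump mechanism does not depend on the level.
\<close>

definition step_space :: "(real \<times> 'e::finite) measure" where
  "step_space = restrict_space borel {0<..} \<Otimes>\<^sub>M count_space UNIV"

definition step_law :: "('e::finite \<Rightarrow> real) \<Rightarrow> real^'e^'e \<Rightarrow> 'e \<Rightarrow> (real \<times> 'e) measure" where
  "step_law lam Q i =
     restrict_space (density lborel (exponential_density (lam i))) {0<..}
       \<Otimes>\<^sub>M point_measure UNIV (\<lambda>j. ennreal (Q $ i $ j))"

primrec phase :: "'e \<Rightarrow> (nat \<Rightarrow> real \<times> 'e) \<Rightarrow> nat \<Rightarrow> 'e" where
  "phase i \<omega> 0 = i"
| "phase i \<omega> (Suc n) = snd (\<omega> n)"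

text \<open>
  The law of \<open>\<omega>\<close> for \<open>J(0) = i\<close>: the measure on the infinite product space that the
  Ionescu-Tulcea theorem provides for the kernels just described.
\<close>

definition path_law ::
    "('e::finite \<Rightarrow> real) \<Rightarrow> real^'e^'e \<Rightarrow> 'e \<Rightarrow> (nat \<Rightarrow> real \<times> 'e) measure" where
  "path_law lam Q i =
     projective_family.lim UNIV
       (Ionescu_Tulcea.CI (\<lambda>n \<omega>. step_law lam Q (phase i \<omega> n)) (\<lambda>_. step_space))
       (\<lambda>_. step_space)"

definition jump_time :: "(nat \<Rightarrow> real \<times> 'e) \<Rightarrow> nat \<Rightarrow> real" where
  "jump_time \<omega> n = (\<Sum>k<n. fst (\<omega> k))"

primrec jump_level ::
    "('e \<Rightarrow> real) \<Rightarrow> ('e \<Rightarrow> real) \<Rightarrow> real \<Rightarrow> 'e \<Rightarrow> (nat \<Rightarrow> real \<times> 'e) \<Rightarrow> nat \<Rightarrow> real" where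
  "jump_level c p v i \<omega> 0 = v"
| "jump_level c p v i \<omega> (Suc n) =
     p (phase i \<omega> n) * (jump_level c p v i \<omega> n + fst (\<omega> n) / c (phase i \<omega> n))"

text \<open>
  The number of jumps in \<open>[0,t]\<close>. Almost surely the jump times tend to infinity and the
  minimum exists; at times beyond an explosion the value is some fixed natural number.
\<close>

definition jump_count :: "(nat \<Rightarrow> real \<times> 'e) \<Rightarrow> real \<Rightarrow> nat" where
  "jump_count \<omega> t = (LEAST n. t < jump_time \<omega> (Suc n))"

definition J_proc :: "'e \<Rightarrow> (nat \<Rightarrow> real \<times> 'e) \<Rightarrow> real \<Rightarrow> 'e" where
  "J_proc i \<omega> t = phase i \<omega> (jump_count \<omega> t)"

definition X_proc ::
    "('e \<Rightarrow> real) \<Rightarrow> ('e \<Rightarrow> real) \<Rightarrow> real \<Rightarrow> 'e \<Rightarrow> (nat \<Rightarrow> real \<times> 'e) \<Rightarrow> real \<Rightarrow> real" where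
  "X_proc c p v i \<omega> t =
     jump_level c p v i \<omega> (jump_count \<omega> t) + (t - jump_time \<omega> (jump_count \<omega> t)) / c (J_proc i \<omega> t)"

section \<open>Passage times and the affine map\<close>

text \<open>Both infima are taken in the extended reals, so a level never reached gives \<open>\<infinity>\<close>.\<close>

definition tau_up ::
    "('e \<Rightarrow> real) \<Rightarrow> ('e \<Rightarrow> real) \<Rightarrow> real \<Rightarrow> real \<Rightarrow> 'e \<Rightarrow> (nat \<Rightarrow> real \<times> 'e) \<Rightarrow> ereal" where
  "tau_up c p a v i \<omega> = Inf {ereal t |t. 0 \<le> t \<and> v + a \<le> X_proc c p v i \<omega> t}"

definition rho ::
    "('e \<Rightarrow> real) \<Rightarrow> ('e \<Rightarrow> real) \<Rightarrow> real \<Rightarrow> 'e \<Rightarrow> (nat \<Rightarrow> real \<times> 'e) \<Rightarrow> ereal" where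
  "rho c p v i \<omega> = Inf {ereal t |t. 0 < t \<and> X_proc c p v i \<omega> t < v}"

definition Z_plus ::
    "('e::finite \<Rightarrow> real) \<Rightarrow> ('e \<Rightarrow> real) \<Rightarrow> ('e \<Rightarrow> real) \<Rightarrow> real^'e^'e \<Rightarrow> real \<Rightarrow> real
      \<Rightarrow> real \<Rightarrow> real^'e^'e" where
  "Z_plus c lam p Q w a v = (\<chi> i j. \<integral>\<omega>.
     (let \<tau> = tau_up c p a v i \<omega>; t = real_of_ereal \<tau>
      in if \<tau> < rho c p v i \<omega> \<and> J_proc i \<omega> t = j then exp (- w * t) else 0)
     \<partial>path_law lam Q i)"

definition V_op ::
    "('e::finite \<Rightarrow> real) \<Rightarrow> ('e \<Rightarrow> real) \<Rightarrow> ('e \<Rightarrow> real) \<Rightarrow> real^'e^'e \<Rightarrow> real \<Rightarrow> real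
      \<Rightarrow> (real \<Rightarrow> real^'e^'e) \<Rightarrow> real \<Rightarrow> real^'e^'e" where
  "V_op c lam p Q w a G v = (\<chi> i j. \<integral>\<omega>.
     (let \<rho> = rho c p v i \<omega>; r = real_of_ereal \<rho>
      in if \<rho> < tau_up c p a v i \<omega>
         then exp (- w * r) * G (X_proc c p v i \<omega> r) $ J_proc i \<omega> r $ j else 0)
     \<partial>path_law lam Q i)"

definition T_op ::
    "('e::finite \<Rightarrow> real) \<Rightarrow> ('e \<Rightarrow> real) \<Rightarrow> ('e \<Rightarrow> real) \<Rightarrow> real^'e^'e \<Rightarrow> real \<Rightarrow> real
      \<Rightarrow> (real \<Rightarrow> real^'e^'e) \<Rightarrow> real \<Rightarrow> real^'e^'e" where
  "T_op c lam p Q w a G v = Z_plus c lam p Q w a v + V_op c lam p Q w a G v"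

definition contraction_const ::
    "('e::finite \<Rightarrow> real) \<Rightarrow> ('e \<Rightarrow> real) \<Rightarrow> real \<Rightarrow> real \<Rightarrow> real" where
  "contraction_const c lam w a =
     (MAX i. let z = c i * (lam i + w) in lam i / (w + lam i) * (1 - exp (- z * a)))"

section \<open>Bounded Borel matrix functions on the positive half-line\<close>

text \<open>Values of \<open>G\<close> outside \<open>{0<..}\<close> are irrelevant throughout.\<close>

definition bounded_borel :: "(real \<Rightarrow> real^'e::finite^'e) \<Rightarrow> bool" where
  "bounded_borel G \<longleftrightarrow>
     G \<in> borel_measurable (restrict_space borel {0<..}) \<and> bounded (G ` {0<..})"

definition row_norm :: "real^'e::finite^'e \<Rightarrow> real" where
  "row_norm A = (MAX i. \<Sum>j\<in>UNIV. \<bar>A $ i $ j\<bar>)"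

definition sup_norm :: "(real \<Rightarrow> real^'e::finite^'e) \<Rightarrow> real" where
  "sup_norm G = (SUP v\<in>{0<..}. row_norm (G v))"

section \<open>The path law is well defined\<close>

lemma sets_step_law: "sets (step_law lam Q i) = sets step_space"
  unfolding step_law_def step_space_def
  by (intro sets_pair_measure_cong) (auto simp: sets_restrict_space sets_point_measure)

lemma prob_space_step_law:
  assumes "0 < lam i" "\<And>j. 0 \<le> Q $ i $ j" "(\<Sum>j\<in>UNIV. Q $ i $ j) = 1"
  shows "prob_space (step_law lam Q i)"
proof -
  let ?D = "density lborel (exponential_density (lam i))"
  let ?E = "restrict_space ?D {0<..}"
  let ?P = "point_measure UNIV (\<lambda>j. ennreal (Q $ i $ j))"
  interpret D: prob_space ?D
    using assms(1) by (rule prob_space_exponential_density)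
  have "emeasure ?D {..0} = 0"
  proof -
    have "AE x in lborel. x \<noteq> (0::real)"
      by (rule AE_lborel_singleton)
    then have "AE x in lborel. ennreal (exponential_density (lam i) x) * indicator {..0} x = 0"
      by eventually_elim (auto simp: exponential_density_def indicator_def)
    then show ?thesis
      by (subst emeasure_density) (auto simp: nn_integral_0_iff_AE)
  qed
  then have "emeasure ?D {0<..} = 1"
    using D.emeasure_space_1 emeasure_Diff[of ?D "{..0}" UNIV]
    by (simp add: Compl_eq_Diff_UNIV[symmetric] greaterThan_def atMost_def not_le flip: Collect_neg_eq)
  then have E: "prob_space ?E"
    by (intro prob_spaceI) (simp add: emeasure_restrict_space space_restrict_space)
  have P: "prob_space ?P"
    using assms(2,3) by (intro prob_spaceI)
      (simp add: emeasure_point_measure_finite space_point_measure sum_ennreal)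
  interpret pair_prob_space ?E ?P
    using E P by (simp add: pair_prob_space_def pair_sigma_finite_def prob_space_imp_sigma_finite)
  show ?thesis
    unfolding step_law_def by (rule prob_space_axioms)
qed

lemma Ionescu_Tulcea_step_law:
  fixes Q :: "real^'e::finite^'e"
  assumes "\<And>i. 0 < lam i" "\<And>i j. 0 \<le> Q $ i $ j" "\<And>i. (\<Sum>j\<in>UNIV. Q $ i $ j) = 1"
  shows "Ionescu_Tulcea (\<lambda>n \<omega>. step_law lam Q (phase i \<omega> n)) (\<lambda>_. step_space)"
proof (rule Ionescu_Tulcea.intro)
  have P: "prob_space (step_law lam Q k)" for k
    using assms by (intro prob_space_step_law) auto
  then show "prob_space (step_law lam Q (phase i \<omega> n))" for n \<omega>
    by simp
  fix n
  have 1: "step_law lam Q \<in> measurable (count_space UNIV) (subprob_algebra step_space)"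
    using P by (auto simp: space_subprob_algebra sets_step_law prob_space_imp_subprob_space)
  have 2: "(\<lambda>\<omega>. phase i \<omega> n) \<in>
      measurable (PiM {0..<n} (\<lambda>_. step_space)) (count_space UNIV)"
  proof (cases n)
    case (Suc k)
    have "snd \<in> measurable (step_space :: (real \<times> 'e) measure) (count_space UNIV)"
      unfolding step_space_def by (rule measurable_snd)
    then show ?thesis
      using Suc by (auto intro!: measurable_compose[OF measurable_component_singleton])
  qed simp
  show "(\<lambda>\<omega>. step_law lam Q (phase i \<omega> n)) \<in>
      measurable (PiM {0..<n} (\<lambda>_. step_space)) (subprob_algebra step_space)"
    by (rule measurable_compose[OF 2 1])
qed

end

theory Submission
  imports Defs
begin

text \<open>
  The term \<open>Z_plus\<close> cancels in a difference \<open>T G - T H\<close>, so only the discounted jump below the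
  starting level matters. Until its first jump, at time \<open>S\<close>, the level increases from \<open>v\<close> with
  slope \<open>1 / c i\<close>. Hence \<open>\<rho> < \<tau>\<close> implies \<open>S \<le> c i * a\<close> and \<open>S \<le> \<rho>\<close>, and row \<open>i\<close> of
  \<open>T G - T H\<close> is at most \<open>sup_norm (G - H)\<close> times the expectation of \<open>exp (- w * S)\<close> on
  \<open>S \<le> c i * a\<close>, which is the \<open>i\<close>-th term of the maximum \<open>\<beta>\<close> because \<open>S\<close> is exponential.

  Measurability rests on the number of jumps being right-constant in time, even beyond an
  explosion: the infima defining \<open>\<tau>\<close> and \<open>\<rho>\<close> may then be taken over rational times.
\<close>

subsection \<open>Joint measurability of the passage times\<close>

abbreviation path_space :: "(nat \<Rightarrow> real \<times> 'e::finite) measure" where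
  "path_space \<equiv> PiM UNIV (\<lambda>_. step_space)"

lemma measurable_holding_time [measurable]:
  "(\<lambda>\<omega>. fst (\<omega> n)) \<in> borel_measurable (path_space :: (nat \<Rightarrow> real \<times> 'e::finite) measure)"
proof -
  have *: "fst \<in> borel_measurable (step_space :: (real \<times> 'e) measure)"
    unfolding step_space_def
    by (rule measurable_compose[OF measurable_fst measurable_restrict_space1]) simp
  show ?thesis
    by (rule measurable_compose[OF _ *]) (rule measurable_component_singleton[OF UNIV_I])
qed

lemma measurable_next_phase [measurable]:
  "(\<lambda>\<omega>. snd (\<omega> n)) \<in> measurable (path_space :: (nat \<Rightarrow> real \<times> 'e::finite) measure) (count_space UNIV)"
proof -
  have *: "snd \<in> measurable (step_space :: (real \<times> 'e) measure) (count_space UNIV)"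
    unfolding step_space_def by (rule measurable_snd)
  show ?thesis
    by (rule measurable_compose[OF _ *]) (rule measurable_component_singleton[OF UNIV_I])
qed

lemma measurable_phase [measurable]:
  "(\<lambda>\<omega>. phase i \<omega> n) \<in> measurable path_space (count_space UNIV)"
  by (cases n) auto

lemma measurable_jump_time [measurable]:
  "(\<lambda>\<omega>. jump_time \<omega> n) \<in> borel_measurable path_space"
  unfolding jump_time_def by measurable

text \<open>Joint measurability in \<open>v\<close> and \<open>\<omega>\<close> is what later makes
  \<open>T_op\<close> Borel in \<open>v\<close>, after \<open>\<omega>\<close> has been integrated
  out.\<close>

lemma measurable_jump_level [measurable]:
  "(\<lambda>(v, \<omega>). jump_level c p v i \<omega> n) \<in> borel_measurable (borel \<Otimes>\<^sub>M path_space)"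
proof (induction n)
  case (Suc n)
  have [measurable]: "(\<lambda>x. f (phase i (snd x) n)) \<in> borel_measurable (borel \<Otimes>\<^sub>M path_space)"
    for f :: "'a \<Rightarrow> real"
    by (rule measurable_compose[OF _ borel_measurable_count_space]) measurable
  have [measurable]: "(\<lambda>x. jump_level c p (fst x) i (snd x) n) \<in> borel_measurable (borel \<Otimes>\<^sub>M path_space)"
    using Suc by (simp add: case_prod_beta')
  show ?case
    unfolding jump_level.simps case_prod_beta' by measurable
qed simp

lemma measurable_jump_count [measurable (raw)]:
  assumes [measurable]: "g \<in> measurable N path_space" "h \<in> borel_measurable N"
  shows "(\<lambda>x. jump_count (g x) (h x)) \<in> measurable N (count_space UNIV)"
  unfolding jump_count_def by measurable

text \<open>The time \<open>h\<close> may depend on the path, since the process is later evaluated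
  at its own passage times. The jump count has countably many values, so measurability at each fixed
  index suffices.\<close>

lemma measurable_J_proc [measurable (raw)]:
  assumes [measurable]: "g \<in> measurable N path_space" "h \<in> borel_measurable N"
  shows "(\<lambda>x. J_proc i (g x) (h x)) \<in> measurable N (count_space UNIV)"
  unfolding J_proc_def
  by (rule measurable_compose_countable[where f = "\<lambda>n x. phase i (g x) n"]) measurable

lemma measurable_X_proc [measurable (raw)]:
  assumes [measurable]: "f \<in> borel_measurable N" "g \<in> measurable N path_space"
    "h \<in> borel_measurable N"
  shows "(\<lambda>x. X_proc c p (f x) i (g x) (h x)) \<in> borel_measurable N"
proof -
  have [measurable]: "(\<lambda>x. c (J_proc i (g x) (h x))) \<in> borel_measurable N"
    by (rule measurable_compose[OF _ borel_measurable_count_space]) measurable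
  have [measurable]: "(\<lambda>x. jump_level c p (f x) i (g x) n) \<in> borel_measurable N" for n
  proof -
    have "(\<lambda>x. (f x, g x)) \<in> measurable N (borel \<Otimes>\<^sub>M path_space)" by measurable
    from measurable_compose[OF this measurable_jump_level] show ?thesis by simp
  qed
  have [measurable]: "(\<lambda>x. jump_level c p (f x) i (g x) (jump_count (g x) (h x))) \<in> borel_measurable N"
    by (rule measurable_compose_countable[where f = "\<lambda>n x. jump_level c p (f x) i (g x) n"]) measurable
  have [measurable]: "(\<lambda>x. jump_time (g x) (jump_count (g x) (h x))) \<in> borel_measurable N"
    by (rule measurable_compose_countable[where f = "\<lambda>n x. jump_time (g x) n"]) measurable
  show ?thesis
    unfolding X_proc_def by measurable
qed

section \<open>Right-continuity and reduction to rational times\<close>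

lemma jump_count_right_constant:
  "\<exists>\<epsilon>>0. \<forall>s\<in>{t..<t + \<epsilon>}. jump_count \<omega> s = jump_count \<omega> t"
proof (cases "\<exists>n. t < jump_time \<omega> (Suc n)")
  case True
  let ?n = "jump_count \<omega> t"
  have n: "t < jump_time \<omega> (Suc ?n)"
    unfolding jump_count_def using True by (rule LeastI_ex)
  have "jump_count \<omega> s = ?n" if "t \<le> s" "s < jump_time \<omega> (Suc ?n)" for s
    unfolding jump_count_def[of _ s]
  proof (rule Least_equality)
    show "?n \<le> k" if "s < jump_time \<omega> (Suc k)" for k
      using that \<open>t \<le> s\<close> unfolding jump_count_def by (intro Least_le) simp
  qed (rule that(2))
  then have "\<forall>s\<in>{t..<t + (jump_time \<omega> (Suc ?n) - t)}. jump_count \<omega> s = ?n"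
    by (metis add.commute atLeastLessThan_iff diff_add_cancel)
  with n show ?thesis
    by (metis diff_gt_0_iff_gt)
next
  case False
  \<comment> \<open>Beyond an explosion the predicate under \<open>LEAST\<close> is identically
    false from \<open>t\<close> on, so \<open>LEAST\<close> returns the same unspecified number at
    all later times.\<close>
  have "(\<lambda>n. s < jump_time \<omega> (Suc n)) = (\<lambda>n. t < jump_time \<omega> (Suc n))" if "t \<le> s" for s
  proof
    show "(s < jump_time \<omega> (Suc n)) = (t < jump_time \<omega> (Suc n))" for n
      using False that by (metis le_less_trans)
  qed
  then have "jump_count \<omega> s = jump_count \<omega> t" if "t \<le> s" for s
    using that unfolding jump_count_def by metis
  then show ?thesis
    by (metis atLeastLessThan_iff zero_less_one)
qed

lemma X_proc_right_affine:
  "\<exists>\<epsilon>>0. \<forall>s\<in>{t..<t + \<epsilon>}. X_proc c p v i \<omega> s = X_proc c p v i \<omega> t + (s - t) / c (J_proc i \<omega> t)"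
proof -
  obtain \<epsilon> where "\<epsilon> > 0" and \<epsilon>: "\<And>s. s \<in> {t..<t + \<epsilon>} \<Longrightarrow> jump_count \<omega> s = jump_count \<omega> t"
    using jump_count_right_constant by metis
  have "X_proc c p v i \<omega> s = X_proc c p v i \<omega> t + (s - t) / c (J_proc i \<omega> t)"
    if "s \<in> {t..<t + \<epsilon>}" for s
    unfolding X_proc_def J_proc_def \<epsilon>[OF that] by (simp add: diff_divide_distrib)
  with \<open>\<epsilon> > 0\<close> show ?thesis by blast
qed

text \<open>Each point of \<open>S\<close> is a limit from the right of rational points of
  \<open>S\<close>, so those have the same infimum. Rationals outside \<open>S\<close> contribute
  \<open>\<infinity>\<close>, which leaves a countable infimum of measurable terms when
  \<open>S\<close> is random.\<close>

lemma Inf_ereal_right_open: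
  fixes S :: "real set"
  assumes S: "\<And>t. t \<in> S \<Longrightarrow> \<exists>\<epsilon>>0. {t..<t + \<epsilon>} \<subseteq> S"
  shows "Inf {ereal t |t. t \<in> S} = (INF q\<in>\<rat>. if q \<in> S then ereal q else \<infinity>)"
proof (rule antisym)
  show "Inf {ereal t |t. t \<in> S} \<le> (INF q\<in>\<rat>. if q \<in> S then ereal q else \<infinity>)"
  proof (rule INF_greatest)
    show "Inf {ereal t |t. t \<in> S} \<le> (if q \<in> S then ereal q else \<infinity>)" for q
    proof (cases "q \<in> S")
      case True
      then have "Inf {ereal t |t. t \<in> S} \<le> ereal q" by (intro Inf_lower) blast
      with True show ?thesis by (simp only: if_True)
    qed (simp only: if_False ereal_less_eq)
  qed
  show "(INF q\<in>\<rat>. if q \<in> S then ereal q else \<infinity>) \<le> Inf {ereal t |t. t \<in> S}"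
  proof (rule Inf_greatest)
    fix x assume "x \<in> {ereal t |t. t \<in> S}"
    then obtain t where t: "x = ereal t" "t \<in> S" by blast
    have "(INF q\<in>\<rat>. if q \<in> S then ereal q else \<infinity>) \<le> x + ereal e" if "0 < e" for e
    proof -
      obtain \<epsilon> where \<epsilon>: "\<epsilon> > 0" "{t..<t + \<epsilon>} \<subseteq> S"
        using S[OF t(2)] by auto
      \<comment> \<open>The bound \<open>\<epsilon>\<close> keeps \<open>q\<close> inside
        \<open>S\<close>, the bound \<open>e\<close> keeps it close to \<open>t\<close>.\<close>
      obtain q where q: "q \<in> \<rat>" "t < q" "q < t + min \<epsilon> e"
        using Rats_dense_in_real[of t "t + min \<epsilon> e"] \<epsilon>(1) \<open>0 < e\<close>
        by (metis less_add_same_cancel1 min_less_iff_conj)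
      then have "q \<in> {t..<t + \<epsilon>}" by simp
      with \<epsilon>(2) have "q \<in> S" by blast
      then have "(INF q\<in>\<rat>. if q \<in> S then ereal q else \<infinity>) \<le> ereal q"
        by (intro INF_lower2[OF q(1)]) (simp only: if_True order.refl)
      also have "ereal q \<le> x + ereal e" using q t by simp
      finally show ?thesis .
    qed
    then show "(INF q\<in>\<rat>. if q \<in> S then ereal q else \<infinity>) \<le> x"
      using ereal_le_epsilon2 by metis
  qed
qed

text \<open>The condition \<open>v + a \<le> X\<close> is closed, but it persists to the right of
  any time at which it holds, because the slope \<open>1 / c\<close> is positive.\<close>

lemma measurable_tau_up [measurable (raw)]:
  assumes c: "\<And>i. 0 < c i"
    and [measurable]: "f \<in> borel_measurable N" "g \<in> measurable N path_space"
  shows "(\<lambda>x. tau_up c p a (f x) i (g x)) \<in> borel_measurable N"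
proof -
  have eq: "tau_up c p a v i \<omega> =
      (INF q\<in>\<rat>. if 0 \<le> q \<and> v + a \<le> X_proc c p v i \<omega> q then ereal q else \<infinity>)" for v \<omega>
  proof -
    have "\<exists>\<epsilon>>0. {t..<t + \<epsilon>} \<subseteq> {t. 0 \<le> t \<and> v + a \<le> X_proc c p v i \<omega> t}"
      if t: "0 \<le> t" "v + a \<le> X_proc c p v i \<omega> t" for t
    proof -
      obtain \<epsilon> where \<epsilon>: "\<epsilon> > 0" "\<And>s. s \<in> {t..<t + \<epsilon>} \<Longrightarrow>
          X_proc c p v i \<omega> s = X_proc c p v i \<omega> t + (s - t) / c (J_proc i \<omega> t)"
        using X_proc_right_affine[of t c p v i \<omega>] by blast
      have *: "0 \<le> (s - t) / c (J_proc i \<omega> t)" if "s \<in> {t..<t + \<epsilon>}" for s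
        using that c[of "J_proc i \<omega> t"] by simp
      have "0 \<le> s \<and> v + a \<le> X_proc c p v i \<omega> s" if "s \<in> {t..<t + \<epsilon>}" for s
        using \<epsilon>(2)[OF that] * [OF that] t that by simp
      with \<epsilon>(1) show ?thesis
        by (intro exI[of _ \<epsilon>]) auto
    qed
    then show ?thesis
      unfolding tau_up_def
      using Inf_ereal_right_open[of "{t. 0 \<le> t \<and> v + a \<le> X_proc c p v i \<omega> t}"] by simp
  qed
  show ?thesis
    unfolding eq by (intro borel_measurable_INF countable_rat) measurable
qed

lemma measurable_rho [measurable (raw)]:
  assumes c: "\<And>i. 0 < c i"
    and [measurable]: "f \<in> borel_measurable N" "g \<in> measurable N path_space"
  shows "(\<lambda>x. rho c p (f x) i (g x)) \<in> borel_measurable N"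
proof -
  have eq: "rho c p v i \<omega> =
      (INF q\<in>\<rat>. if 0 < q \<and> X_proc c p v i \<omega> q < v then ereal q else \<infinity>)" for v \<omega>
  proof -
    have "\<exists>\<epsilon>>0. {t..<t + \<epsilon>} \<subseteq> {t. 0 < t \<and> X_proc c p v i \<omega> t < v}"
      if t: "0 < t" "X_proc c p v i \<omega> t < v" for t
    proof -
      let ?l = "\<lambda>s. X_proc c p v i \<omega> t + (s - t) / c (J_proc i \<omega> t)"
      obtain \<epsilon> where \<epsilon>: "\<epsilon> > 0" "\<And>s. s \<in> {t..<t + \<epsilon>} \<Longrightarrow> X_proc c p v i \<omega> s = ?l s"
        using X_proc_right_affine[of t c p v i \<omega>] by blast
      \<comment> \<open>The time that a line of slope \<open>1 / c\<close> needs to climb from the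
        level at \<open>t\<close> back to \<open>v\<close>.\<close>
      let ?\<delta> = "c (J_proc i \<omega> t) * (v - X_proc c p v i \<omega> t)"
      have "X_proc c p v i \<omega> s < v" if "s \<in> {t..<t + \<epsilon>}" "s < t + ?\<delta>" for s
      proof -
        have "(s - t) / c (J_proc i \<omega> t) < v - X_proc c p v i \<omega> t"
          using that(2) c[of "J_proc i \<omega> t"] by (simp add: pos_divide_less_eq mult.commute)
        then show ?thesis using \<epsilon>(2)[OF that(1)] by simp
      qed
      moreover have "0 < ?\<delta>" using c t by simp
      ultimately show ?thesis
        using \<open>\<epsilon> > 0\<close> \<open>0 < t\<close> by (intro exI[of _ "min \<epsilon> ?\<delta>"]) auto
    qed
    then show ?thesis
      unfolding rho_def
      using Inf_ereal_right_open[of "{t. 0 < t \<and> X_proc c p v i \<omega> t < v}"] by simp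
  qed
  show ?thesis
    unfolding eq by (intro borel_measurable_INF countable_rat) measurable
qed

subsection \<open>Paths up to the first jump\<close>

lemma tau_up_nonneg: "0 \<le> tau_up c p a v i \<omega>"
  unfolding tau_up_def by (rule Inf_greatest) auto

lemma rho_nonneg: "0 \<le> rho c p v i \<omega>"
  unfolding rho_def by (rule Inf_greatest) auto

lemma space_path_space_pos: "\<omega> \<in> space path_space \<Longrightarrow> 0 < fst (\<omega> n)"
  by (auto simp: space_PiM step_space_def space_pair_measure space_restrict_space PiE_iff mem_Times_iff)

text \<open>No index below a \<open>LEAST\<close> value satisfies the predicate, even if no index
  satisfies it at all; hence the bound also holds beyond an explosion.\<close>

lemma jump_time_le: "0 \<le> t \<Longrightarrow> jump_time \<omega> (jump_count \<omega> t) \<le> t"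
proof (cases "jump_count \<omega> t")
  case (Suc n)
  then have "\<not> t < jump_time \<omega> (Suc n)"
    using not_less_Least[of n "\<lambda>n. t < jump_time \<omega> (Suc n)"] unfolding jump_count_def by simp
  then show ?thesis using Suc by simp
qed (simp add: jump_time_def)

text \<open>Jumps multiply a positive level by a positive factor, and the level rises in between.
  This keeps the process in the half-line on which \<open>G\<close> is controlled.\<close>

lemma X_proc_pos:
  assumes c: "\<And>i. 0 < c i" and p: "\<And>i. 0 < p i" and "0 < v" "0 \<le> t" and \<omega>: "\<And>n. 0 < fst (\<omega> n)"
  shows "0 < X_proc c p v i \<omega> t"
proof -
  have "0 < jump_level c p v i \<omega> n" for n
    by (induction n) (simp_all add: \<open>0 < v\<close> c p \<omega> add_pos_pos)
  moreover have "0 \<le> (t - jump_time \<omega> (jump_count \<omega> t)) / c (J_proc i \<omega> t)"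
    using jump_time_le[OF \<open>0 \<le> t\<close>, of \<omega>] c[of "J_proc i \<omega> t"] by simp
  ultimately show ?thesis
    unfolding X_proc_def by (simp add: add_pos_nonneg)
qed

lemma X_proc_before_first_jump:
  assumes "t < fst (\<omega> 0)"
  shows "X_proc c p v i \<omega> t = v + t / c i"
proof -
  have "jump_count \<omega> t = 0"
    unfolding jump_count_def using assms by (intro Least_equality) (auto simp: jump_time_def)
  then show ?thesis by (simp add: X_proc_def J_proc_def jump_time_def)
qed

text \<open>Before the first jump the path lies strictly above \<open>v\<close> at positive times.
  Equality may fail, since the first jump can land at or above \<open>v\<close>.\<close>

lemma rho_ge_first_jump:
  assumes "0 < c i"
  shows "ereal (fst (\<omega> 0)) \<le> rho c p v i \<omega>"
  unfolding rho_def
proof (safe intro!: Inf_greatest)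
  fix t :: real
  assume t: "0 < t" "X_proc c p v i \<omega> t < v"
  have "0 < t / c i" using assms t by simp
  with t X_proc_before_first_jump[of t \<omega> c p v i] show "ereal (fst (\<omega> 0)) \<le> ereal t"
    by (cases "t < fst (\<omega> 0)") auto
qed

lemma rho_less_tau_up_first_jump:
  assumes c: "0 < c i" and "0 < a" and less: "rho c p v i \<omega> < tau_up c p a v i \<omega>"
  shows "fst (\<omega> 0) \<le> c i * a" "fst (\<omega> 0) \<le> real_of_ereal (rho c p v i \<omega>)"
proof -
  have ge: "ereal (fst (\<omega> 0)) \<le> rho c p v i \<omega>" using rho_ge_first_jump c by metis
  show "fst (\<omega> 0) \<le> c i * a"
  proof (rule ccontr)
    \<comment> \<open>Without a jump up to time \<open>c i * a\<close> the level climbs by exactly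
      \<open>a\<close>, so the upper level is reached no later than \<open>\<rho>\<close>.\<close>
    assume *: "\<not> ?thesis"
    then have "X_proc c p v i \<omega> (c i * a) = v + a"
      using c by (subst X_proc_before_first_jump) auto
    then have "tau_up c p a v i \<omega> \<le> ereal (c i * a)"
      unfolding tau_up_def using c \<open>0 < a\<close>
      by (intro Inf_lower) (auto intro!: exI[of _ "c i * a"])
    also have "\<dots> \<le> ereal (fst (\<omega> 0))" using * by simp
    finally show False using ge less by simp
  qed
  \<comment> \<open>Finiteness is needed because \<open>real_of_ereal\<close> sends
    \<open>\<infinity>\<close> to 0.\<close>
  have eq: "rho c p v i \<omega> \<noteq> \<infinity>" using less by auto
  with ge rho_nonneg[of c p v i \<omega>] show "fst (\<omega> 0) \<le> real_of_ereal (rho c p v i \<omega>)"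
    by (cases "rho c p v i \<omega>") auto
qed

subsection \<open>Matrix functions\<close>

text \<open>Entries in any Euclidean space are allowed, so that two applications reduce a matrix
  function to its real entries.\<close>

lemma borel_measurable_vec:
  fixes f :: "'b \<Rightarrow> 'a::euclidean_space^'n"
  assumes "\<And>i. (\<lambda>x. f x $ i) \<in> borel_measurable M"
  shows "f \<in> borel_measurable M"
  unfolding borel_measurable_euclidean_space[of f]
proof
  fix b :: "'a^'n"
  assume "b \<in> Basis"
  then obtain i u where "b = axis i u" by (auto simp: Basis_vec_def)
  with assms[of i] show "(\<lambda>x. f x \<bullet> b) \<in> borel_measurable M"
    by (simp add: inner_axis)
qed

lemma borel_measurable_matrix_entry:
  "(\<lambda>A::real^'n^'m. A $ i $ j) \<in> borel_measurable borel"
  by (intro borel_measurable_continuous_onI continuous_intros)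

lemma abs_matrix_entry_le_norm: "\<bar>A $ i $ j\<bar> \<le> norm (A :: real^'n^'m)"
  by (meson Finite_Cartesian_Product.norm_nth_le component_le_norm_cart order_trans)

lemma row_sum_le_row_norm: "(\<Sum>j\<in>UNIV. \<bar>A $ i $ j\<bar>) \<le> row_norm A"
  unfolding row_norm_def by (intro Max_ge) auto

lemma row_norm_leI: "(\<And>i. (\<Sum>j\<in>UNIV. \<bar>A $ i $ j\<bar>) \<le> b) \<Longrightarrow> row_norm A \<le> b"
  unfolding row_norm_def by (intro Max.boundedI) auto

lemma row_norm_nonneg: "0 \<le> row_norm A"
  by (rule order_trans[OF sum_nonneg row_sum_le_row_norm]) simp

lemma bounded_borel_bound:
  assumes "bounded_borel G"
  obtains B where "0 \<le> B" "\<And>x. 0 < x \<Longrightarrow> norm (G x) \<le> B"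
proof -
  obtain B where "\<And>x. 0 < x \<Longrightarrow> norm (G x) \<le> B"
    using assms unfolding bounded_borel_def bounded_iff by auto
  then show thesis
    by (intro that[of "max 0 B"]) (auto simp: le_max_iff_disj)
qed

text \<open>A real supremum dominates its members only for a family bounded above; boundedness of
  \<open>G\<close> and \<open>H\<close> supplies a crude bound, with one factor for the number of
  columns.\<close>

lemma row_norm_diff_le_sup_norm:
  assumes G: "bounded_borel G" and H: "bounded_borel H" and "0 < x"
  shows "row_norm (G x - H x) \<le> sup_norm (\<lambda>v. G v - H v)"
proof -
  obtain B where B: "\<And>x. 0 < x \<Longrightarrow> norm (G x) \<le> B" using G bounded_borel_bound by metis
  obtain C where C: "\<And>x. 0 < x \<Longrightarrow> norm (H x) \<le> C" using H bounded_borel_bound by metis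
  have "row_norm (G v - H v) \<le> of_nat CARD('a) * (B + C)" if "0 < v" for v
  proof (rule row_norm_leI, rule sum_bounded_above)
    fix i j
    have "\<bar>(G v - H v) $ i $ j\<bar> \<le> norm (G v - H v)" by (rule abs_matrix_entry_le_norm)
    also have "\<dots> \<le> B + C"
      using B[OF that] C[OF that] norm_triangle_ineq4[of "G v" "H v"] by linarith
    finally show "\<bar>(G v - H v) $ i $ j\<bar> \<le> B + C" .
  qed
  then have "bdd_above ((\<lambda>v. row_norm (G v - H v)) ` {0<..})"
    by (intro bdd_aboveI2[where M = "of_nat CARD('a) * (B + C)"]) simp
  then show ?thesis
    unfolding sup_norm_def using \<open>0 < x\<close> by (intro cSUP_upper) simp_all
qed

subsection \<open>The law of the first jump\<close>

locale piecewise_linear_jump_process =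
  fixes c lam p :: "'e::finite \<Rightarrow> real" and Q :: "real^'e^'e" and w a :: real
  assumes c: "\<And>i. 0 < c i"
    and lam: "\<And>i. 0 < lam i"
    and p: "\<And>i. 0 < p i"
    and Q_nonneg: "\<And>i j. 0 \<le> Q $ i $ j"
    and Q_rows: "\<And>i. (\<Sum>j\<in>UNIV. Q $ i $ j) = 1"
    and w: "0 < w"
    and a: "0 < a"
begin

lemma IT: "Ionescu_Tulcea (\<lambda>n \<omega>. step_law lam Q (phase i \<omega> n)) (\<lambda>_. step_space)"
  using lam Q_nonneg Q_rows by (rule Ionescu_Tulcea_step_law)

lemma sets_path_law [measurable_cong]: "sets (path_law lam Q i) = sets path_space"
proof -
  interpret Ionescu_Tulcea "\<lambda>n \<omega>. step_law lam Q (phase i \<omega> n)" "\<lambda>_. step_space"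
    by (rule IT)
  show ?thesis unfolding path_law_def by (rule PF.sets_lim)
qed

lemma space_path_law: "space (path_law lam Q i) = space path_space"
  using sets_path_law by (rule sets_eq_imp_space_eq)

text \<open>An event about the first coordinate is a cylinder over the index set \<open>{0}\<close>.
  There the projective limit agrees with the finite-dimensional law, which is the kernel started
  from the empty history.\<close>

lemma distr_first_step: "distr (path_law lam Q i) step_space (\<lambda>\<omega>. \<omega> 0) = step_law lam Q i"
proof (rule measure_eqI)
  interpret Ionescu_Tulcea "\<lambda>n \<omega>. step_law lam Q (phase i \<omega> n)" "\<lambda>_. step_space"
    by (rule IT)
  fix A :: "(real \<times> 'e) set"
  assume "A \<in> sets (distr (path_law lam Q i) step_space (\<lambda>\<omega>. \<omega> 0))"
  then have A [measurable]: "A \<in> sets step_space" by simp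
  \<comment> \<open>\<open>?u\<close> is the empty history, the only point of the product over no
    indices.\<close>
  let ?K = "{0..<Suc 0}" and ?u = "\<lambda>_::nat. undefined :: real \<times> 'e"
  define X where "X = (\<lambda>\<omega>. \<omega> 0) -` A \<inter> space (PiM ?K (\<lambda>_. step_space :: (real \<times> 'e) measure))"
  have X: "X \<in> sets (PiM ?K (\<lambda>_. step_space))"
    unfolding X_def by (rule measurable_sets[OF _ A]) (rule measurable_component_singleton, simp)
  have u: "?u \<in> space (PiM {0..<0} (\<lambda>_. step_space))"
    by (simp add: space_PiM)
  have "emeasure (distr (path_law lam Q i) step_space (\<lambda>\<omega>. \<omega> 0)) A
      = emeasure (path_law lam Q i) ((\<lambda>\<omega>. \<omega> 0) -` A \<inter> space (path_law lam Q i))"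
    by (rule emeasure_distr) (simp_all add: measurable_cong_sets[OF sets_path_law refl])
  also have "(\<lambda>\<omega>. \<omega> 0) -` A \<inter> space (path_law lam Q i) = prod_emb UNIV (\<lambda>_. step_space) ?K X"
    by (auto simp: X_def space_path_law prod_emb_def space_PiM PiE_iff) metis
  also have "emeasure (path_law lam Q i) \<dots> = emeasure (CI ?K) X"
    unfolding path_law_def by (rule lim) (use X in simp_all)
  also have "\<dots> = emeasure (C 0 (Suc 0) ?u) (prod_emb ?K (\<lambda>_. step_space) ?K X)"
    by (rule emeasure_CI) (use X in simp_all)
  also have "prod_emb ?K (\<lambda>_. step_space) ?K X = X"
    by (rule prod_emb_id) (auto simp: X_def space_PiM)
  also have "C 0 (Suc 0) ?u = eP 0 ?u"
    using bind_return[OF measurable_eP u] by simp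
  also have "emeasure (eP 0 ?u) X = emeasure (step_law lam Q i) ((\<lambda>x. ?u(0 := x)) -` X \<inter> space step_space)"
    using emeasure_eP[OF u X] by simp
  also have "(\<lambda>x. ?u(0 := x)) -` X \<inter> space step_space = A"
    using sets.sets_into_space[OF A] by (auto simp: X_def space_PiM PiE_iff extensional_def)
  finally show "emeasure (distr (path_law lam Q i) step_space (\<lambda>\<omega>. \<omega> 0)) A
      = emeasure (step_law lam Q i) A" .
qed (simp add: sets_step_law)

text \<open>A push-forward preserves total mass, so the mass can be read off the first
  marginal.\<close>

lemma prob_space_path_law: "prob_space (path_law lam Q i)"
proof (rule prob_space_distrD)
  show "(\<lambda>\<omega>. \<omega> 0) \<in> measurable (path_law lam Q i) step_space"
    by (simp add: measurable_cong_sets[OF sets_path_law refl])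
  show "prob_space (distr (path_law lam Q i) step_space (\<lambda>\<omega>. \<omega> 0))"
    unfolding distr_first_step using lam Q_nonneg Q_rows by (intro prob_space_step_law)
qed

text \<open>The step law is a product, so the next phase integrates out with mass 1 and the
  exponential law on the positive half-line remains.\<close>

lemma nn_integral_first_holding_time:
  assumes f: "f \<in> borel_measurable borel"
  shows "(\<integral>\<^sup>+\<omega>. f (fst (\<omega> 0)) \<partial>path_law lam Q i)
    = (\<integral>\<^sup>+x\<in>{0<..}. ennreal (exponential_density (lam i) x) * f x \<partial>lborel)"
proof -
  let ?D = "density lborel (exponential_density (lam i))"
  let ?E = "restrict_space ?D {0<..}" and ?P = "point_measure UNIV (\<lambda>j. ennreal (Q $ i $ j))"
  note f [measurable]
  interpret P: prob_space ?P
    using Q_nonneg Q_rows by (intro prob_spaceI)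
      (simp add: emeasure_point_measure_finite space_point_measure sum_ennreal)
  have fE: "f \<in> borel_measurable ?E"
    by (rule measurable_restrict_space1) simp
  have fs: "(\<lambda>s. f (fst s)) \<in> borel_measurable (?E \<Otimes>\<^sub>M ?P)"
    by (rule measurable_compose[OF measurable_fst fE])
  have fs': "(\<lambda>s. f (fst s)) \<in> borel_measurable (step_space :: (real \<times> 'e) measure)"
    using fs unfolding measurable_cong_sets[OF sets_step_law[unfolded step_law_def] refl] .
  have "(\<integral>\<^sup>+\<omega>. f (fst (\<omega> 0)) \<partial>path_law lam Q i) = (\<integral>\<^sup>+s. f (fst s) \<partial>step_law lam Q i)"
    unfolding distr_first_step[symmetric]
    by (rule nn_integral_distr[symmetric])
      (use fs' in \<open>simp_all add: measurable_cong_sets[OF sets_path_law refl]\<close>)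
  also have "\<dots> = (\<integral>\<^sup>+x. \<integral>\<^sup>+j. f x \<partial>?P \<partial>?E)"
    unfolding step_law_def by (subst P.nn_integral_fst[OF fs, symmetric]) simp
  also have "\<dots> = (\<integral>\<^sup>+x. f x \<partial>?E)"
    by (simp add: P.emeasure_space_1)
  also have "\<dots> = (\<integral>\<^sup>+x. f x * indicator {0<..} x \<partial>?D)"
    by (subst nn_integral_restrict_space) simp_all
  also have "\<dots> = (\<integral>\<^sup>+x\<in>{0<..}. ennreal (exponential_density (lam i) x) * f x \<partial>lborel)"
    by (subst nn_integral_density) (auto simp: mult.assoc)
  finally show ?thesis .
qed

lemma integral_discounted_first_jump:
  assumes "0 \<le> b"
  shows "(\<integral>\<omega>. indicator {..b} (fst (\<omega> 0)) * exp (- w * fst (\<omega> 0)) \<partial>path_law lam Q i)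
    = lam i / (w + lam i) * (1 - exp (- (lam i + w) * b))"
proof -
  let ?f = "\<lambda>x::real. indicator {..b} x * exp (- w * x)"
  \<comment> \<open>An antiderivative of the exponential density times the discount factor, whose
    exponents add up to \<open>- (lam i + w) * x\<close>.\<close>
  let ?F = "\<lambda>x. - lam i / (w + lam i) * exp (- (lam i + w) * x)"
  have pos: "0 < w + lam i" using lam[of i] w by simp
  have "(\<integral>\<^sup>+\<omega>. ennreal (?f (fst (\<omega> 0))) \<partial>path_law lam Q i)
      = (\<integral>\<^sup>+x\<in>{0<..}. ennreal (exponential_density (lam i) x) * ennreal (?f x) \<partial>lborel)"
    by (rule nn_integral_first_holding_time) simp
  \<comment> \<open>The integrands differ only at 0, a null set; the closed interval is the form
    that the fundamental theorem of calculus takes.\<close>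
  also have "\<dots> = (\<integral>\<^sup>+x. ennreal (lam i * exp (- (lam i + w) * x)) * indicator {0..b} x \<partial>lborel)"
  proof (rule nn_integral_cong_AE)
    have "AE x in lborel. x \<noteq> (0::real)" by (rule AE_lborel_singleton)
    then show "AE x in lborel.
        ennreal (exponential_density (lam i) x) * ennreal (?f x) * indicator {0<..} x
        = ennreal (lam i * exp (- (lam i + w) * x)) * indicator {0..b} x"
    proof eventually_elim
      case (elim x)
      have "- (lam i + w) * x = - x * lam i + - w * x" by (simp add: algebra_simps)
      then have "exp (- (lam i + w) * x) = exp (- x * lam i) * exp (- w * x)"
        by (simp only: exp_add)
      with elim lam[of i] show ?case
        by (auto simp: exponential_density_def indicator_def simp flip: ennreal_mult)
    qed
  qed
  also have "\<dots> = ennreal (?F b - ?F 0)"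
  proof (rule nn_integral_FTC_Icc)
    show "(\<lambda>x. lam i * exp (- (lam i + w) * x)) \<in> borel_measurable borel" by measurable
    show "0 \<le> lam i * exp (- (lam i + w) * x)" for x using lam[of i] by simp
    have "((\<lambda>x. exp (- (lam i + w) * x)) has_real_derivative
        exp (- (lam i + w) * x) * - (lam i + w)) (at x)" for x
      by (auto intro!: derivative_eq_intros)
    from DERIV_cmult[OF this, of "- lam i / (w + lam i)"]
    have "(?F has_real_derivative - lam i / (w + lam i) * (exp (- (lam i + w) * x) * - (lam i + w))) (at x)" for x .
    moreover have "- lam i / (w + lam i) * (E * - (lam i + w)) = lam i * E" for E
      using pos by (simp add: field_simps)
    ultimately show "(?F has_real_derivative lam i * exp (- (lam i + w) * x)) (at x)" for x
      by simp
  qed (use assms in simp_all)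
  also have "?F b - ?F 0 = lam i / (w + lam i) * (1 - exp (- (lam i + w) * b))"
    by (simp add: algebra_simps)
  finally have "(\<integral>\<^sup>+\<omega>. ennreal (?f (fst (\<omega> 0))) \<partial>path_law lam Q i)
      = ennreal (lam i / (w + lam i) * (1 - exp (- (lam i + w) * b)))" .
  moreover have "0 \<le> lam i / (w + lam i) * (1 - exp (- (lam i + w) * b))"
    using pos lam[of i] assms
    by (intro mult_nonneg_nonneg) (simp_all add: mult_nonpos_nonneg)
  moreover have "(\<lambda>\<omega>. ?f (fst (\<omega> 0))) \<in> borel_measurable (path_law lam Q i)"
    by measurable
  ultimately show ?thesis
    by (subst integral_eq_nn_integral) simp_all
qed

subsection \<open>The affine map\<close>

text \<open>In this integrand and in \<open>V_integrand\<close> an infinite passage time fails the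
  strict comparison, so the default value 0 of \<open>real_of_ereal\<close> never enters.\<close>

definition Z_integrand :: "real \<Rightarrow> 'e \<Rightarrow> 'e \<Rightarrow> (nat \<Rightarrow> real \<times> 'e) \<Rightarrow> real" where
  "Z_integrand v i j \<omega> =
     (let \<tau> = tau_up c p a v i \<omega>; t = real_of_ereal \<tau>
      in if \<tau> < rho c p v i \<omega> \<and> J_proc i \<omega> t = j then exp (- w * t) else 0)"

definition V_integrand ::
    "(real \<Rightarrow> real^'e^'e) \<Rightarrow> real \<Rightarrow> 'e \<Rightarrow> 'e \<Rightarrow> (nat \<Rightarrow> real \<times> 'e) \<Rightarrow> real" where
  "V_integrand G v i j \<omega> =
     (let \<rho> = rho c p v i \<omega>; r = real_of_ereal \<rho>
      in if \<rho> < tau_up c p a v i \<omega>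
         then exp (- w * r) * G (X_proc c p v i \<omega> r) $ J_proc i \<omega> r $ j else 0)"

lemma T_op_entry:
  "T_op c lam p Q w a G v $ i $ j
     = (\<integral>\<omega>. Z_integrand v i j \<omega> \<partial>path_law lam Q i) + (\<integral>\<omega>. V_integrand G v i j \<omega> \<partial>path_law lam Q i)"
  by (simp add: T_op_def Z_plus_def V_op_def Z_integrand_def V_integrand_def)

lemma measurable_Z_integrand:
  "(\<lambda>(v, \<omega>). Z_integrand v i j \<omega>) \<in> borel_measurable (borel \<Otimes>\<^sub>M path_space)"
proof -
  have [measurable]: "(\<lambda>x. tau_up c p a (fst x) i (snd x)) \<in> borel_measurable (borel \<Otimes>\<^sub>M path_space)"
    "(\<lambda>x. rho c p (fst x) i (snd x)) \<in> borel_measurable (borel \<Otimes>\<^sub>M path_space)"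
    by (rule measurable_tau_up measurable_rho; (rule c | measurable))+
  show ?thesis
    unfolding Z_integrand_def Let_def case_prod_beta' by measurable
qed

lemma measurable_V_integrand:
  assumes [measurable]: "G \<in> borel_measurable borel"
  shows "(\<lambda>(v, \<omega>). V_integrand G v i j \<omega>) \<in> borel_measurable (borel \<Otimes>\<^sub>M path_space)"
proof -
  let ?N = "borel \<Otimes>\<^sub>M path_space :: (real \<times> (nat \<Rightarrow> real \<times> 'e)) measure"
  have [measurable]: "(\<lambda>x. tau_up c p a (fst x) i (snd x)) \<in> borel_measurable ?N"
    "(\<lambda>x. rho c p (fst x) i (snd x)) \<in> borel_measurable ?N"
    by (rule measurable_tau_up measurable_rho; (rule c | measurable))+
  let ?r = "\<lambda>x. real_of_ereal (rho c p (fst x) i (snd x))"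
  have [measurable]: "(\<lambda>x. G (X_proc c p (fst x) i (snd x) (?r x)) $ k $ j) \<in> borel_measurable ?N" for k
    by (rule measurable_compose[OF _ borel_measurable_matrix_entry]) measurable
  have [measurable]:
    "(\<lambda>x. G (X_proc c p (fst x) i (snd x) (?r x)) $ J_proc i (snd x) (?r x) $ j) \<in> borel_measurable ?N"
    by (rule measurable_compose_countable[where
        f = "\<lambda>k x. G (X_proc c p (fst x) i (snd x) (?r x)) $ k $ j"]) measurable
  show ?thesis
    unfolding V_integrand_def Let_def case_prod_beta' by measurable
qed

text \<open>A bounded Borel \<open>G\<close> is controlled on the positive half-line only; its extension by zero
  is Borel everywhere and agrees with \<open>G\<close> at all levels the process attains.\<close>

definition zero_ext :: "(real \<Rightarrow> real^'e^'e) \<Rightarrow> real \<Rightarrow> real^'e^'e" where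
  "zero_ext G x = (if 0 < x then G x else 0)"

lemma borel_measurable_zero_ext: "bounded_borel G \<Longrightarrow> zero_ext G \<in> borel_measurable borel"
  using measurable_restrict_space_iff[of "{0<..}" borel 0 borel G]
  by (simp add: bounded_borel_def zero_ext_def[abs_def])

text \<open>This includes \<open>rho = \<infinity>\<close>, where the conversion gives time 0 and
  the level is again positive.\<close>

lemma X_proc_rho_pos:
  assumes "0 < v" "\<omega> \<in> space path_space"
  shows "0 < X_proc c p v i \<omega> (real_of_ereal (rho c p v i \<omega>))"
  using assms by (intro X_proc_pos c p real_of_ereal_pos rho_nonneg space_path_space_pos)

lemma V_integrand_zero_ext:
  assumes "0 < v" "\<omega> \<in> space path_space"
  shows "V_integrand (zero_ext G) v i j \<omega> = V_integrand G v i j \<omega>"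
  using X_proc_rho_pos[OF assms] by (simp add: V_integrand_def zero_ext_def Let_def)

section \<open>Bounds and integrability of the integrands\<close>

lemma abs_Z_integrand_le: "\<bar>Z_integrand v i j \<omega>\<bar> \<le> 1"
  using w tau_up_nonneg[of c p a v i \<omega>]
  by (simp add: Z_integrand_def Let_def real_of_ereal_pos)

lemma abs_V_integrand_le:
  assumes "0 < v" "\<omega> \<in> space path_space" and B: "0 \<le> B" "\<And>x. 0 < x \<Longrightarrow> norm (G x) \<le> B"
  shows "\<bar>V_integrand G v i j \<omega>\<bar> \<le> B"
proof -
  let ?r = "real_of_ereal (rho c p v i \<omega>)"
  let ?g = "G (X_proc c p v i \<omega> ?r) $ J_proc i \<omega> ?r $ j"
  have "\<bar>?g\<bar> \<le> B"
    using B(2)[OF X_proc_rho_pos[OF assms(1,2)]] abs_matrix_entry_le_norm order_trans by blast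
  moreover have "exp (- w * ?r) \<le> 1"
    using w by (simp add: real_of_ereal_pos rho_nonneg)
  ultimately have "exp (- w * ?r) * \<bar>?g\<bar> \<le> 1 * B"
    by (intro mult_mono) simp_all
  with B(1) show ?thesis
    by (simp add: V_integrand_def Let_def abs_mult)
qed

lemma integrable_V_integrand:
  assumes G: "bounded_borel G" and v: "0 < v"
  shows "integrable (path_law lam Q i) (V_integrand G v i j)"
proof -
  interpret prob_space "path_law lam Q i" by (rule prob_space_path_law)
  obtain B where B: "0 \<le> B" "\<And>x. 0 < x \<Longrightarrow> norm (G x) \<le> B" using G bounded_borel_bound by metis
  have "(\<lambda>\<omega>. (v, \<omega>)) \<in> measurable path_space (borel \<Otimes>\<^sub>M path_space)" by simp
  from measurable_compose[OF this measurable_V_integrand[OF borel_measurable_zero_ext[OF G]]]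
  have "(\<lambda>\<omega>. V_integrand (zero_ext G) v i j \<omega>) \<in> borel_measurable path_space" by simp
  \<comment> \<open>Measurability is transferred from the zero extension, which is Borel on the
    whole line.\<close>
  also have "?this \<longleftrightarrow> V_integrand G v i j \<in> borel_measurable path_space"
    by (rule measurable_cong) (simp add: V_integrand_zero_ext v)
  finally have "V_integrand G v i j \<in> borel_measurable (path_law lam Q i)"
    by (simp add: measurable_cong_sets[OF sets_path_law refl])
  then show ?thesis
    using abs_V_integrand_le[OF v _ B] space_path_law
    by (intro integrable_const_bound[where B = B] AE_I2) simp_all
qed

section \<open>Invariance of the bounded Borel matrix functions\<close>

lemma bounded_borel_T_op:
  assumes G: "bounded_borel G"
  shows "bounded_borel (T_op c lam p Q w a G)"
proof -
  obtain B where B: "0 \<le> B" "\<And>x. 0 < x \<Longrightarrow> norm (G x) \<le> B" using G bounded_borel_bound by metis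
  have "(\<lambda>v. T_op c lam p Q w a G v $ i $ j) \<in> borel_measurable (restrict_space borel {0<..})" for i j
  proof -
    interpret prob_space "path_law lam Q i" by (rule prob_space_path_law)
    have sets: "sets (borel \<Otimes>\<^sub>M path_law lam Q i) = sets (borel \<Otimes>\<^sub>M path_space)"
      by (rule sets_pair_measure_cong) (simp_all add: sets_path_law)
    \<comment> \<open>Integrating out one variable of a jointly measurable function leaves a
      measurable function of the other.\<close>
    have "(\<lambda>v. (\<integral>\<omega>. Z_integrand v i j \<omega> \<partial>path_law lam Q i)
        + (\<integral>\<omega>. V_integrand (zero_ext G) v i j \<omega> \<partial>path_law lam Q i)) \<in> borel_measurable borel"
      using measurable_Z_integrand[of i j] measurable_V_integrand[OF borel_measurable_zero_ext[OF G], of i j]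
      by (intro borel_measurable_add borel_measurable_lebesgue_integral)
        (simp_all add: measurable_cong_sets[OF sets refl])
    then have "(\<lambda>v. (\<integral>\<omega>. Z_integrand v i j \<omega> \<partial>path_law lam Q i)
        + (\<integral>\<omega>. V_integrand (zero_ext G) v i j \<omega> \<partial>path_law lam Q i))
        \<in> borel_measurable (restrict_space borel {0<..})"
      by (rule measurable_restrict_space1)
    also have "?this \<longleftrightarrow> ?thesis"
    proof (rule measurable_cong)
      fix v :: real
      assume "v \<in> space (restrict_space borel {0<..})"
      then have "0 < v" by (simp add: space_restrict_space)
      then have "(\<integral>\<omega>. V_integrand (zero_ext G) v i j \<omega> \<partial>path_law lam Q i)
          = (\<integral>\<omega>. V_integrand G v i j \<omega> \<partial>path_law lam Q i)"
        by (intro Bochner_Integration.integral_cong) (simp_all add: space_path_law V_integrand_zero_ext)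
      then show "(\<integral>\<omega>. Z_integrand v i j \<omega> \<partial>path_law lam Q i)
          + (\<integral>\<omega>. V_integrand (zero_ext G) v i j \<omega> \<partial>path_law lam Q i) = T_op c lam p Q w a G v $ i $ j"
        by (simp add: T_op_entry)
    qed
    finally show ?thesis .
  qed
  then have "T_op c lam p Q w a G \<in> borel_measurable (restrict_space borel {0<..})"
    by (intro borel_measurable_vec)
  \<comment> \<open>Each entry is at most 1 from \<open>Z_integrand\<close> plus \<open>B\<close>
    from \<open>V_integrand\<close>; the two cardinalities come from bounding Euclidean norms by
    sums, over columns and then over rows.\<close>
  moreover have "norm (T_op c lam p Q w a G v) \<le> of_nat CARD('e) * (of_nat CARD('e) * (1 + B))"
    if v: "0 < v" for v
  proof -
    have "\<bar>T_op c lam p Q w a G v $ i $ j\<bar> \<le> 1 + B" for i j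
    proof -
      interpret prob_space "path_law lam Q i" by (rule prob_space_path_law)
      have bound: "\<bar>\<integral>\<omega>. f \<omega> \<partial>path_law lam Q i\<bar> \<le> C"
        if "\<And>\<omega>. \<omega> \<in> space path_space \<Longrightarrow> \<bar>f \<omega>\<bar> \<le> C" "0 \<le> C" for f :: "(nat \<Rightarrow> real \<times> 'e) \<Rightarrow> real" and C
      proof -
        have "\<bar>\<integral>\<omega>. f \<omega> \<partial>path_law lam Q i\<bar> \<le> (\<integral>\<omega>. \<bar>f \<omega>\<bar> \<partial>path_law lam Q i)"
          by (rule integral_abs_bound)
        also have "\<dots> \<le> (\<integral>\<omega>. C \<partial>path_law lam Q i)"
          by (rule integral_mono') (use that in \<open>simp_all add: space_path_law\<close>)
        finally show ?thesis by (simp add: prob_space)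
      qed
      have "\<bar>\<integral>\<omega>. Z_integrand v i j \<omega> \<partial>path_law lam Q i\<bar> \<le> 1"
        by (rule bound) (simp_all add: abs_Z_integrand_le)
      moreover have "\<bar>\<integral>\<omega>. V_integrand G v i j \<omega> \<partial>path_law lam Q i\<bar> \<le> B"
        by (rule bound) (use abs_V_integrand_le[OF v _ B] B(1) in simp_all)
      ultimately show ?thesis unfolding T_op_entry by linarith
    qed
    then have "norm (T_op c lam p Q w a G v $ i) \<le> of_nat CARD('e) * (1 + B)" for i
      by (intro order_trans[OF norm_le_l1_cart] sum_bounded_above) simp
    then show ?thesis
      unfolding norm_vec_def[of "T_op c lam p Q w a G v"]
      by (intro order_trans[OF L2_set_le_sum] sum_bounded_above) simp_all
  qed
  ultimately show ?thesis
    unfolding bounded_borel_def bounded_iff by auto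
qed

section \<open>The contraction estimate\<close>

lemma sum_abs_V_integrand_diff_le:
  assumes G: "bounded_borel G" and H: "bounded_borel H" and v: "0 < v" and \<omega>: "\<omega> \<in> space path_space"
  shows "(\<Sum>j\<in>UNIV. \<bar>V_integrand G v i j \<omega> - V_integrand H v i j \<omega>\<bar>)
    \<le> indicator {..c i * a} (fst (\<omega> 0)) * exp (- w * fst (\<omega> 0)) * sup_norm (\<lambda>v. G v - H v)"
proof (cases "rho c p v i \<omega> < tau_up c p a v i \<omega>")
  case True
  let ?r = "real_of_ereal (rho c p v i \<omega>)"
  let ?A = "G (X_proc c p v i \<omega> ?r) - H (X_proc c p v i \<omega> ?r)"
  have first: "fst (\<omega> 0) \<le> c i * a" "fst (\<omega> 0) \<le> ?r"
    using rho_less_tau_up_first_jump[OF c a True] .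
  \<comment> \<open>All columns \<open>j\<close> share one discount factor and one row index
    \<open>J_proc\<close>, so the sum is a single row sum of the matrix \<open>?A\<close>.\<close>
  have "(\<Sum>j\<in>UNIV. \<bar>V_integrand G v i j \<omega> - V_integrand H v i j \<omega>\<bar>)
      = exp (- w * ?r) * (\<Sum>j\<in>UNIV. \<bar>?A $ J_proc i \<omega> ?r $ j\<bar>)"
    using True by (simp add: V_integrand_def Let_def abs_mult sum_distrib_left flip: right_diff_distrib)
  also have "\<dots> \<le> exp (- w * fst (\<omega> 0)) * sup_norm (\<lambda>v. G v - H v)"
  proof (rule mult_mono)
    show "exp (- w * ?r) \<le> exp (- w * fst (\<omega> 0))" using first(2) w by simp
    show "(\<Sum>j\<in>UNIV. \<bar>?A $ J_proc i \<omega> ?r $ j\<bar>) \<le> sup_norm (\<lambda>v. G v - H v)"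
      using row_norm_diff_le_sup_norm[OF G H X_proc_rho_pos[OF v \<omega>]]
      by (rule order_trans[OF row_sum_le_row_norm])
  qed (simp_all add: sum_nonneg)
  finally show ?thesis using first(1) by simp
next
  case False
  \<comment> \<open>Both integrands vanish here, so only the sign of the right-hand side
    matters.\<close>
  have "0 \<le> sup_norm (\<lambda>v. G v - H v)"
    using row_norm_nonneg row_norm_diff_le_sup_norm[OF G H v] by (rule order_trans)
  then show ?thesis using False by (simp add: V_integrand_def Let_def)
qed

lemma row_norm_T_op_diff_le:
  assumes G: "bounded_borel G" and H: "bounded_borel H" and v: "0 < v"
  shows "row_norm (T_op c lam p Q w a G v - T_op c lam p Q w a H v)
    \<le> contraction_const c lam w a * sup_norm (\<lambda>v. G v - H v)"
proof (rule row_norm_leI)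
  fix i
  let ?M = "path_law lam Q i" and ?K = "sup_norm (\<lambda>v. G v - H v)"
  let ?d = "\<lambda>j \<omega>. V_integrand G v i j \<omega> - V_integrand H v i j \<omega>"
  let ?f = "\<lambda>\<omega>::nat \<Rightarrow> real \<times> 'e. indicator {..c i * a} (fst (\<omega> 0)) * exp (- w * fst (\<omega> 0)) :: real"
  interpret prob_space ?M by (rule prob_space_path_law)
  have K: "0 \<le> ?K"
    using row_norm_nonneg row_norm_diff_le_sup_norm[OF G H v] by (rule order_trans)
  have d: "integrable ?M (?d j)" for j
    using G H v by (intro Bochner_Integration.integrable_diff integrable_V_integrand)
  have f: "integrable ?M ?f"
  proof (rule integrable_const_bound[where B = 1])
    show "?f \<in> borel_measurable ?M" by measurable
    have "0 \<le> w * fst (\<omega> 0)" if "\<omega> \<in> space path_space" for \<omega> :: "nat \<Rightarrow> real \<times> 'e"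
      using w space_path_space_pos[OF that] by (simp add: less_imp_le)
    then show "AE \<omega> in ?M. norm (?f \<omega>) \<le> 1"
      by (intro AE_I2) (simp add: space_path_law indicator_def)
  qed
  have "(\<Sum>j\<in>UNIV. \<bar>(T_op c lam p Q w a G v - T_op c lam p Q w a H v) $ i $ j\<bar>)
      = (\<Sum>j\<in>UNIV. \<bar>\<integral>\<omega>. ?d j \<omega> \<partial>?M\<bar>)"
    using integrable_V_integrand[OF G v] integrable_V_integrand[OF H v]
    by (simp add: T_op_entry)
  also have "\<dots> \<le> (\<Sum>j\<in>UNIV. \<integral>\<omega>. \<bar>?d j \<omega>\<bar> \<partial>?M)"
    by (intro sum_mono integral_abs_bound)
  \<comment> \<open>The row sum goes under the integral before it is estimated; bounding the entries
    one by one by the whole row bound would cost a factor \<open>CARD('e)\<close>.\<close>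
  also have "\<dots> = (\<integral>\<omega>. (\<Sum>j\<in>UNIV. \<bar>?d j \<omega>\<bar>) \<partial>?M)"
    using d by (intro Bochner_Integration.integral_sum[symmetric] integrable_abs)
  also have "\<dots> \<le> (\<integral>\<omega>. ?f \<omega> * ?K \<partial>?M)"
    using d f sum_abs_V_integrand_diff_le[OF G H v]
    by (intro integral_mono Bochner_Integration.integrable_sum integrable_abs integrable_mult_left)
      (simp_all add: space_path_law)
  also have "\<dots> = lam i / (w + lam i) * (1 - exp (- (lam i + w) * (c i * a))) * ?K"
    using integral_discounted_first_jump[of "c i * a" i] c[of i] a by simp
  also have "\<dots> \<le> contraction_const c lam w a * ?K"
  proof (rule mult_right_mono)
    have eq: "- (lam i + w) * (c i * a) = - (c i * (lam i + w)) * a"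
      by (simp add: algebra_simps)
    show "lam i / (w + lam i) * (1 - exp (- (lam i + w) * (c i * a))) \<le> contraction_const c lam w a"
      unfolding contraction_const_def Let_def eq by (intro Max_ge) simp_all
  qed (rule K)
  finally show "(\<Sum>j\<in>UNIV. \<bar>(T_op c lam p Q w a G v - T_op c lam p Q w a H v) $ i $ j\<bar>)
      \<le> contraction_const c lam w a * ?K" .
qed

text \<open>Strictness comes from \<open>lam i / (w + lam i) < 1\<close>, that is, from discounting,
  and it survives the maximum because there are finitely many phases.\<close>

lemma contraction_const_less_1: "contraction_const c lam w a < 1"
proof -
  have "lam i / (w + lam i) * (1 - exp (- (c i * (lam i + w)) * a)) < 1" for i
  proof -
    have "lam i / (w + lam i) * (1 - exp (- (c i * (lam i + w)) * a)) \<le> lam i / (w + lam i) * 1"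
      using lam[of i] w by (intro mult_left_mono) simp_all
    also have "\<dots> < 1" using lam[of i] w by simp
    finally show ?thesis .
  qed
  then show ?thesis
    unfolding contraction_const_def Let_def by (subst Max_less_iff) auto
qed

end

theorem lemma6p1:
  fixes c lam p :: "'e::finite \<Rightarrow> real" and Q :: "real^'e^'e" and w a :: real
  assumes c: "\<And>i. 0 < c i"
    and lam: "\<And>i. 0 < lam i"
    and p: "\<And>i. 0 < p i \<and> p i < 1"
    and Q_nonneg: "\<And>i j. 0 \<le> Q $ i $ j"
    and Q_rows: "\<And>i. (\<Sum>j\<in>UNIV. Q $ i $ j) = 1"
    and w: "0 < w"
    and a: "0 < a"
  shows "contraction_const c lam w a < 1 \<and>
    (\<forall>G. bounded_borel G \<longrightarrow> bounded_borel (T_op c lam p Q w a G)) \<and>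
    (\<forall>G H. bounded_borel G \<longrightarrow> bounded_borel H \<longrightarrow>
       sup_norm (\<lambda>v. T_op c lam p Q w a G v - T_op c lam p Q w a H v)
         \<le> contraction_const c lam w a * sup_norm (\<lambda>v. G v - H v))"
proof -
  interpret piecewise_linear_jump_process c lam p Q w a
    using assms by unfold_locales auto
  have "sup_norm (\<lambda>v. T_op c lam p Q w a G v - T_op c lam p Q w a H v)
      \<le> contraction_const c lam w a * sup_norm (\<lambda>v. G v - H v)"
    if "bounded_borel G" "bounded_borel H" for G H
    \<comment> \<open>Only the left-hand supremum is opened, to be bounded pointwise; the right-hand
      norm stays as the constant bound.\<close>
    unfolding sup_norm_def[of "\<lambda>v. T_op c lam p Q w a G v - T_op c lam p Q w a H v"]
    using row_norm_T_op_diff_le[OF that] by (intro cSUP_least) auto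
  then show ?thesis
    using contraction_const_less_1 bounded_borel_T_op by blast
qed

end
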